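(* Let $s\ge 1$ be an integer and let $0<x<1$ be real. Then: (i) if $s$ is even, $$\frac{\Delta_s(x)}{Z_s(x)}=\prod_{k=1}^{\infty}\frac{1-x^k}{1+x^k}=\theta_4(0,x);$$ (ii) if $s$ is odd, $$\frac{\Delta_s(x)}{Z_s(x)}=\prod_{k=1}^{\infty}\frac{(1-x^k)(1+x^{sk})}{(1+x^k)(1-x^{sk})}=\frac{\theta_4(0,x)}{\theta_4(0,x^s)}.$$
   Context: The parafermionic partition function of order $s$ is $Z_s(x)=\prod_{k\ge1}\sum_{i=0}^{s-1}x^{ik}$, and the graded parafermionic partition function of order $s$ is $\Delta_s(x)=\prod_{k\ge1}\sum_{i=0}^{s-1}(-1)^i x^{ik}$. In the physical setting $x=e^{-\beta\omega}$ with $\beta,\omega>0$. The Jacobi theta function is $\theta_4(0,x)=\sum_{n=-\infty}^{\infty}(-1)^n x^{n^2}$. *)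

theory Defs
  imports "HOL-Analysis.Analysis"
begin

text \<open>
  Products over \<open>k \<ge> 1\<close> are written as library products over \<open>k \<ge> 0\<close> with \<open>k\<close> replaced by \<open>Suc k\<close>.
\<close>

definition parafermionic_Z :: "nat \<Rightarrow> real \<Rightarrow> real" where
  "parafermionic_Z s x = (\<Prod>k. \<Sum>i<s. x ^ (i * Suc k))"

definition graded_parafermionic_Z :: "nat \<Rightarrow> real \<Rightarrow> real" where
  "graded_parafermionic_Z s x = (\<Prod>k. \<Sum>i<s. (-1) ^ i * x ^ (i * Suc k))"

text \<open>The theta constant \<open>\<theta>\<^sub>4(0, q)\<close>, as a function of the nome \<open>q\<close>.\<close>

definition theta4_zero :: "real \<Rightarrow> real" where
  "theta4_zero q = (\<Sum>\<^sub>\<infinity>n\<in>(UNIV :: int set). (-1) powi n * q powi (n\<^sup>2))"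


text \<open>
  Both \<open>prodinf\<close> and \<open>infsum\<close> are total functions; the following facts show that the definitions
  above denote convergent products and sums, with nonzero partition function, for \<open>0 < x < 1\<close>.
\<close>

lemma convergent_prod_parafermionic_aux:
  fixes c :: "nat \<Rightarrow> real"
  assumes "s \<ge> 1" "0 < x" "x < 1" "c 0 = 1" "\<And>i. \<bar>c i\<bar> \<le> 1"
  shows "convergent_prod (\<lambda>k. \<Sum>i<s. c i * x ^ (i * Suc k))"
proof -
  obtain m where s: "s = Suc m"
    using assms(1) by (cases s) auto
  have eq: "(\<Sum>i<s. c i * x ^ (i * Suc k)) - 1 = (\<Sum>i<m. c (Suc i) * x ^ (Suc i * Suc k))" for k
    unfolding s by (subst sum.lessThan_Suc_shift) (simp add: assms(4))
  have bound: "norm (norm ((\<Sum>i<s. c i * x ^ (i * Suc k)) - 1)) \<le> real m * x ^ k" for k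
  proof -
    have "\<bar>\<Sum>i<m. c (Suc i) * x ^ (Suc i * Suc k)\<bar> \<le> (\<Sum>i<m. x ^ k)"
    proof (rule order_trans[OF sum_abs sum_mono])
      fix i
      have "\<bar>c (Suc i) * x ^ (Suc i * Suc k)\<bar> = \<bar>c (Suc i)\<bar> * x ^ (Suc i * Suc k)"
        using assms(2) by (simp add: abs_mult)
      also have "\<dots> \<le> 1 * x ^ (Suc i * Suc k)"
        using assms(2) by (intro mult_right_mono assms(5)) simp
      also have "\<dots> \<le> x ^ k"
        unfolding mult_1 using assms(2,3) by (intro power_decreasing) auto
      finally show "\<bar>c (Suc i) * x ^ (Suc i * Suc k)\<bar> \<le> x ^ k" .
    qed
    then show ?thesis
      unfolding eq by simp
  qed
  have "summable (\<lambda>k. real m * x ^ k)"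
    using assms(2,3) by (intro summable_mult summable_geometric) simp
  then have "summable (\<lambda>k. norm ((\<Sum>i<s. c i * x ^ (i * Suc k)) - 1))"
    by (rule summable_comparison_test') (rule bound)
  then show ?thesis
    by (intro abs_convergent_prod_imp_convergent_prod)
       (simp add: abs_convergent_prod_conv_summable)
qed

lemma has_prod_parafermionic_Z:
  assumes "s \<ge> 1" "0 < x" "x < 1"
  shows "(\<lambda>k. \<Sum>i<s. x ^ (i * Suc k)) has_prod parafermionic_Z s x"
  unfolding parafermionic_Z_def
  using convergent_prod_parafermionic_aux[OF assms, of "\<lambda>_. 1"]
  by (simp add: convergent_prod_has_prod)

lemma has_prod_graded_parafermionic_Z:
  assumes "s \<ge> 1" "0 < x" "x < 1"
  shows "(\<lambda>k. \<Sum>i<s. (-1) ^ i * x ^ (i * Suc k)) has_prod graded_parafermionic_Z s x"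
  unfolding graded_parafermionic_Z_def
  using convergent_prod_parafermionic_aux[OF assms, of "\<lambda>i. (-1) ^ i"]
  by (simp add: convergent_prod_has_prod power_abs)

lemma parafermionic_Z_nonzero:
  assumes "s \<ge> 1" "0 < x" "x < 1"
  shows "parafermionic_Z s x \<noteq> 0"
proof
  assume "parafermionic_Z s x = 0"
  then have "0 \<in> range (\<lambda>k. \<Sum>i<s. x ^ (i * Suc k))"
    using has_prod_eq_0_iff[OF has_prod_parafermionic_Z[OF assms]] by blast
  then obtain k where "(\<Sum>i<s. x ^ (i * Suc k)) = 0"
    by (metis (no_types, lifting) rangeE)
  moreover have "(\<Sum>i<s. x ^ (i * Suc k)) > 0"
    using assms by (intro sum_pos) (auto simp: lessThan_empty_iff)
  ultimately show False
    by simp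
qed

lemma theta4_zero_summable:
  fixes q :: real
  assumes "0 < q" "q < 1"
  shows "(\<lambda>n::int. (-1) powi n * q powi (n\<^sup>2)) summable_on UNIV"
proof -
  let ?f = "\<lambda>n::int. (-1) powi n * q powi (n\<^sup>2)"
  have geo: "(\<lambda>n. q ^ n) summable_on (UNIV :: nat set)"
    using assms by (intro norm_summable_imp_summable_on) (simp add: summable_geometric)
  have norm_f: "norm (?f n) \<le> q ^ nat \<bar>n\<bar>" for n
  proof -
    have "\<bar>n\<bar> * 1 \<le> \<bar>n\<bar> * \<bar>n\<bar>"
      by (cases "n = 0", simp) (rule mult_left_mono, linarith+)
    then have "nat \<bar>n\<bar> \<le> nat (n\<^sup>2)"
      by (simp add: power2_eq_square nat_mono)
    then have "q ^ nat (n\<^sup>2) \<le> q ^ nat \<bar>n\<bar>"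
      using assms by (intro power_decreasing) auto
    moreover have "norm (?f n) = q ^ nat (n\<^sup>2)"
      using assms by (simp add: abs_mult power_int_abs power_int_def power_abs)
    ultimately show ?thesis
      by simp
  qed
  have inj: "inj int" "inj (\<lambda>n. - int n)"
    by (auto simp: inj_on_def)
  have "?f summable_on range h" if "inj h" "\<And>n. nat \<bar>h n\<bar> = n" for h :: "nat \<Rightarrow> int"
  proof -
    have "(\<lambda>n. norm (?f (h n))) summable_on UNIV"
      by (rule summable_on_comparison_test[OF geo]) (use norm_f that(2) in \<open>metis, simp\<close>)
    then have "(\<lambda>n. ?f (h n)) summable_on UNIV"
      by (rule abs_summable_summable)
    then show ?thesis
      using summable_on_reindex[OF that(1), of ?f] by (simp add: o_def)
  qed
  from this[of int] this[of "\<lambda>n. - int n"] inj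
  have "?f summable_on (range int \<union> range (\<lambda>n. - int n))"
    by (intro summable_on_union) auto
  moreover have "range int \<union> range (\<lambda>n. - int n) = UNIV"
    by (auto simp: image_iff) (metis int_cases2)
  ultimately show ?thesis
    by simp
qed

end

theory Submission
  imports Defs
begin

text \<open>
  Geometric summation turns the \<open>k\<close>-th factors of \<open>\<Delta>\<^sub>s\<close> and \<open>Z\<^sub>s\<close> into
  \<open>(1 - (-1)\<^sup>s x\<^bsup>sk\<^esup>) / (1 + x\<^sup>k)\<close> and \<open>(1 - x\<^bsup>sk\<^esup>) / (1 - x\<^sup>k)\<close>,
  so everything reduces to Gauss' identity \<open>P\<^sub>\<infinity> = \<theta>\<^sub>4(0, x)\<close> for
  \<open>P\<^sub>n = (\<Prod>k=1..n. (1 - x\<^sup>k) / (1 + x\<^sup>k))\<close>.  Following Shanks, the partial sum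
  \<open>\<Sum>j=-n..n. (-1)\<^sup>j x\<^bsup>j\<^sup>2\<^esup>\<close> equals
  \<open>\<Sum>j=0..n. (-1)\<^sup>j \<cdot> 2 / (1 + x\<^sup>j) \<cdot> P\<^sub>n / P\<^sub>j \<cdot> x\<^bsup>j(n+1)\<^esup>\<close>, whose term
  for \<open>j = 0\<close> is \<open>P\<^sub>n\<close>, while the remaining terms are bounded by \<open>2 x\<^sup>n\<close> each.
\<close>

section \<open>Geometric sums and the ratio of the two products\<close>

lemma sum_power_mult_eq:
  fixes x :: real
  assumes "0 < x" "x < 1"
  shows "(\<Sum>i<s. x ^ (i * Suc k)) = (1 - x ^ (s * Suc k)) / (1 - x ^ Suc k)"
proof -
  have "x ^ Suc k < 1"
    using assms by (simp add: power_less_one_iff del: power_Suc)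
  then have "(\<Sum>i<s. (x ^ Suc k) ^ i) = (1 - (x ^ Suc k) ^ s) / (1 - x ^ Suc k)"
    by (subst sum_gp_strict) auto
  then show ?thesis
    by (simp only: power_mult[symmetric] mult.commute[of "Suc k"])
qed

text \<open>The geometric ratio is now \<open>- (x ^ Suc k)\<close>; the sign
  \<open>(-1) ^ s\<close> left in the numerator is the source of the parity split.\<close>

lemma sum_alternating_power_mult_eq:
  fixes x :: real
  assumes "0 < x"
  shows "(\<Sum>i<s. (-1) ^ i * x ^ (i * Suc k)) = (1 - (-1) ^ s * x ^ (s * Suc k)) / (1 + x ^ Suc k)"
proof -
  have pos: "x ^ Suc k > 0"
    using assms by (rule zero_less_power)
  have eq: "(- (x ^ Suc k)) ^ i = (-1) ^ i * x ^ (i * Suc k)" for i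
    by (subst power_minus) (simp only: power_mult[symmetric] mult.commute[of "Suc k"])
  have "(\<Sum>i<s. (- (x ^ Suc k)) ^ i) = (1 - (- (x ^ Suc k)) ^ s) / (1 + x ^ Suc k)"
    using pos by (subst sum_gp_strict) auto
  then show ?thesis
    unfolding eq .
qed

text \<open>For even \<open>s\<close> both closed forms have the numerator
  \<open>1 - x ^ (s * Suc k)\<close>. It cancels in every factor, so the product no longer depends
  on \<open>s\<close>.\<close>

lemma has_prod_graded_ratio_even:
  assumes "s \<ge> 1" "0 < x" "x < 1" "even s"
  shows "(\<lambda>k. (1 - x ^ Suc k) / (1 + x ^ Suc k))
           has_prod (graded_parafermionic_Z s x / parafermionic_Z s x)"
proof -
  \<comment> \<open>The second bound makes the cancelled numerator nonzero.\<close>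
  have less: "x ^ Suc k < 1" "x ^ (s * Suc k) < 1" "x ^ Suc k > 0" for k
    using assms by (simp_all add: power_less_one_iff del: power_Suc)
  have "(\<Sum>i<s. (-1) ^ i * x ^ (i * Suc k)) / (\<Sum>i<s. x ^ (i * Suc k))
          = (1 - x ^ Suc k) / (1 + x ^ Suc k)" for k
    using less[of k] assms(4)
    by (simp add: sum_power_mult_eq[OF assms(2,3)] sum_alternating_power_mult_eq[OF assms(2)]
          divide_simps del: power_Suc mult_Suc_right)
  with has_prod_divide[OF has_prod_graded_parafermionic_Z[OF assms(1-3)]
      has_prod_parafermionic_Z[OF assms(1-3)]]
  show ?thesis
    by simp
qed

lemma has_prod_graded_ratio_odd:
  assumes "s \<ge> 1" "0 < x" "x < 1" "odd s"
  shows "(\<lambda>k. ((1 - x ^ Suc k) * (1 + x ^ (s * Suc k))) / ((1 + x ^ Suc k) * (1 - x ^ (s * Suc k))))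
           has_prod (graded_parafermionic_Z s x / parafermionic_Z s x)"
proof -
  have "(\<Sum>i<s. (-1) ^ i * x ^ (i * Suc k)) / (\<Sum>i<s. x ^ (i * Suc k))
          = ((1 - x ^ Suc k) * (1 + x ^ (s * Suc k))) / ((1 + x ^ Suc k) * (1 - x ^ (s * Suc k)))" for k
    using assms(4)
    by (simp add: sum_power_mult_eq[OF assms(2,3)] sum_alternating_power_mult_eq[OF assms(2)]
          mult.commute del: power_Suc mult_Suc_right)
  with has_prod_divide[OF has_prod_graded_parafermionic_Z[OF assms(1-3)]
      has_prod_parafermionic_Z[OF assms(1-3)]]
  show ?thesis
    by simp
qed

section \<open>Shanks' finite form of Gauss' identity\<close>

definition gauss_prod :: "real \<Rightarrow> nat \<Rightarrow> real" where
  "gauss_prod x n = (\<Prod>k<n. (1 - x ^ Suc k) / (1 + x ^ Suc k))"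

lemma gauss_prod_0 [simp]: "gauss_prod x 0 = 1"
  by (simp add: gauss_prod_def)

lemma gauss_prod_Suc: "gauss_prod x (Suc n) = gauss_prod x n * ((1 - x ^ Suc n) / (1 + x ^ Suc n))"
  by (simp add: gauss_prod_def)

lemma gauss_prod_pos:
  assumes "0 < x" "x < 1"
  shows "gauss_prod x n > 0"
  unfolding gauss_prod_def
  using assms
  by (intro prod_pos ballI divide_pos_pos)
     (simp_all add: power_less_one_iff add_pos_pos del: power_Suc)

lemma gauss_prod_antimono:
  assumes "0 < x" "x < 1" "m \<le> n"
  shows "gauss_prod x n \<le> gauss_prod x m"
  using assms(3)
proof (induction n rule: dec_induct)
  case (step n)
  have "x ^ Suc n > 0"
    using assms(1) by (rule zero_less_power)
  then have "(1 - x ^ Suc n) / (1 + x ^ Suc n) \<le> 1"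
    by (simp add: divide_simps)
  then have "gauss_prod x (Suc n) \<le> gauss_prod x n"
    unfolding gauss_prod_Suc using gauss_prod_pos[OF assms(1,2), of n]
    by (intro mult_left_le) auto
  with step.IH show ?case
    by simp
qed simp

text \<open>The factor \<open>2 / (1 + x ^ j)\<close> equals 1 at \<open>j = 0\<close> and is below
  2 for every \<open>j\<close> when \<open>0 < x\<close>. The quotient of products equals 1 at
  \<open>j = n\<close>.\<close>

definition shanks_term :: "real \<Rightarrow> nat \<Rightarrow> nat \<Rightarrow> real" where
  "shanks_term x n j = (-1) ^ j * (2 / (1 + x ^ j)) * (gauss_prod x n / gauss_prod x j) * x ^ (j * Suc n)"

text \<open>Adding the difference of index \<open>Suc m\<close> to the closed form for
  \<open>m\<close> gives the closed form for \<open>Suc m\<close>. At \<open>m = n\<close> the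
  products cancel and the power becomes \<open>x ^ (Suc n)\<^sup>2\<close>, the next one in the
  theta sum.\<close>

lemma sum_shanks_term_diff:
  assumes "0 < x" "x < 1"
  shows "(\<Sum>j\<le>m. shanks_term x (Suc n) j - shanks_term x n j)
           = (-1) ^ Suc m * (2 / (1 + x ^ Suc n)) * (gauss_prod x n / gauss_prod x m) * x ^ (Suc n * Suc m)"
proof (induction m)
  case 0
  have "x ^ Suc n > 0"
    using assms(1) by (rule zero_less_power)
  then show ?case
    by (simp add: shanks_term_def gauss_prod_Suc divide_simps del: power_Suc)
       (simp add: algebra_simps)
next
  case (Suc m)
  \<comment> \<open>With these names, raising \<open>n\<close> or \<open>m\<close> by one multiplies
    \<open>e\<close> by \<open>a\<close> or \<open>b\<close>, and the induction step becomes a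
    rational identity.\<close>
  define a b e where "a = x ^ Suc m" and "b = x ^ Suc n" and "e = x ^ (Suc m * Suc n)"
  define P Q where "P = gauss_prod x n" and "Q = gauss_prod x m"
  have pos: "a > 0" "b > 0" "Q > 0"
    using assms by (simp_all add: a_def b_def Q_def gauss_prod_pos)
  have a1: "a < 1"
    using assms by (simp add: a_def power_less_one_iff del: power_Suc)
  have powers: "x ^ (Suc m * Suc (Suc n)) = e * a" "x ^ (Suc n * Suc (Suc m)) = e * b"
      "x ^ (Suc n * Suc m) = e"
    unfolding e_def a_def b_def by (simp_all add: power_add[symmetric] algebra_simps)
  have "(\<Sum>j\<le>Suc m. shanks_term x (Suc n) j - shanks_term x n j)
      = (-1) ^ Suc m * (2 / (1 + b)) * (P / Q) * e
        + ((-1) ^ Suc m * (2 / (1 + a)) * (P * ((1 - b) / (1 + b)) / (Q * ((1 - a) / (1 + a)))) * (e * a)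
           - (-1) ^ Suc m * (2 / (1 + a)) * (P / (Q * ((1 - a) / (1 + a)))) * e)"
    unfolding sum.atMost_Suc Suc.IH unfolding shanks_term_def gauss_prod_Suc powers
    by (simp only: a_def b_def e_def P_def Q_def)
  \<comment> \<open>Up to common factors this is
    \<open>(1 - a) + a * (1 - b) - (1 + b) = - b * (1 + a)\<close>.\<close>
  also have "\<dots> = (-1) ^ m * (2 / (1 + b)) * (P / (Q * ((1 - a) / (1 + a)))) * (e * b)"
  proof -
    have nz: "1 + a \<noteq> 0" "1 - a \<noteq> 0" "1 + b \<noteq> 0" "Q \<noteq> 0"
      using pos a1 by auto
    show ?thesis
      using nz by (simp add: divide_simps) algebra
  qed
  also have "\<dots> = (-1) ^ Suc (Suc m) * (2 / (1 + x ^ Suc n)) * (gauss_prod x n / gauss_prod x (Suc m))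
                    * x ^ (Suc n * Suc (Suc m))"
    unfolding gauss_prod_Suc powers by (simp add: a_def b_def P_def Q_def)
  finally show ?case .
qed

text \<open>Passing from \<open>n\<close> to \<open>Suc n\<close> changes the old terms by the
  telescoped total and adds one new last term. Together these are the two theta terms of index
  \<open>Suc n\<close> and its negative.\<close>

lemma theta4_partial_sum:
  fixes x :: real
  assumes "0 < x" "x < 1"
  shows "1 + 2 * (\<Sum>j<n. (-1) ^ Suc j * x ^ (Suc j)\<^sup>2) = (\<Sum>j\<le>n. shanks_term x n j)"
proof (induction n)
  case 0
  show ?case
    by (simp add: shanks_term_def)
next
  case (Suc n)
  define b e where "b = x ^ Suc n" and "e = x ^ (Suc n)\<^sup>2"
  have "b > 0"
    using assms by (simp add: b_def)
  have e: "x ^ (Suc n * Suc n) = e" "x ^ (Suc n * Suc (Suc n)) = e * b"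
    by (simp_all add: e_def b_def power2_eq_square power_add[symmetric] algebra_simps)
  have "(\<Sum>j\<le>Suc n. shanks_term x (Suc n) j)
      = (\<Sum>j\<le>n. shanks_term x n j) + (\<Sum>j\<le>n. shanks_term x (Suc n) j - shanks_term x n j)
        + shanks_term x (Suc n) (Suc n)"
    by (simp add: sum_subtractf)
  also have "(\<Sum>j\<le>n. shanks_term x (Suc n) j - shanks_term x n j) = (-1) ^ Suc n * (2 / (1 + b)) * e"
    unfolding sum_shanks_term_diff[OF assms] e b_def
    using gauss_prod_pos[OF assms, of n] by simp
  also have "shanks_term x (Suc n) (Suc n) = (-1) ^ Suc n * (2 / (1 + b)) * (e * b)"
    unfolding shanks_term_def e b_def using gauss_prod_pos[OF assms, of "Suc n"] by simp
  \<comment> \<open>The two contributions carry \<open>e\<close> and \<open>e * b\<close>; their sum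
    \<open>e * (1 + b)\<close> cancels the denominator.\<close>
  also have "(\<Sum>j\<le>n. shanks_term x n j) + (-1) ^ Suc n * (2 / (1 + b)) * e
        + (-1) ^ Suc n * (2 / (1 + b)) * (e * b)
      = (\<Sum>j\<le>n. shanks_term x n j) + 2 * ((-1) ^ Suc n * e)"
    using \<open>b > 0\<close> by (simp add: divide_simps) algebra
  finally show ?case
    unfolding Suc.IH[symmetric] e_def by simp
qed

text \<open>The products decrease, so their quotient is at most 1, and the exponent
  \<open>Suc j * Suc n\<close> is at least \<open>n\<close>. The bound is uniform in
  \<open>j\<close>.\<close>

lemma abs_shanks_term_le:
  assumes "0 < x" "x < 1" "Suc j \<le> n"
  shows "\<bar>shanks_term x n (Suc j)\<bar> \<le> 2 * x ^ n"
proof -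
  have pos: "gauss_prod x i > 0" for i
    using assms by (simp add: gauss_prod_pos)
  have q: "gauss_prod x n / gauss_prod x (Suc j) \<le> 1"
    using gauss_prod_antimono[OF assms] pos by (simp add: divide_simps)
  have "x ^ Suc j > 0"
    using assms(1) by (rule zero_less_power)
  then have a: "2 / (1 + x ^ Suc j) \<le> 2" "0 \<le> 2 / (1 + x ^ Suc j)"
    by (simp_all add: divide_simps del: power_Suc)
  have "\<bar>shanks_term x n (Suc j)\<bar>
      = 2 / (1 + x ^ Suc j) * (gauss_prod x n / gauss_prod x (Suc j)) * x ^ (Suc j * Suc n)"
    using a(2) pos assms(1) unfolding shanks_term_def
    by (simp only: abs_mult power_abs abs_minus_cancel abs_one power_one mult_1 abs_of_nonneg
          abs_of_pos zero_less_power divide_pos_pos)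
  also have "\<dots> \<le> 2 * 1 * x ^ n"
    using a q pos assms
    by (intro mult_mono power_decreasing mult_nonneg_nonneg) (auto intro: less_imp_le)
  finally show ?thesis
    by simp
qed

section \<open>Passage to the limit and the theta constant\<close>

lemma theta4_partial_sum_tendsto:
  fixes x :: real
  assumes "0 < x" "x < 1"
  shows "(\<lambda>n. 1 + 2 * (\<Sum>j<n. (-1) ^ Suc j * x ^ (Suc j)\<^sup>2))
           \<longlonglongrightarrow> (\<Prod>k. (1 - x ^ Suc k) / (1 + x ^ Suc k))"
proof -
  \<comment> \<open>Convergence is read off from the even case, with 2 as a sample order.\<close>
  have "(\<lambda>k. (1 - x ^ Suc k) / (1 + x ^ Suc k)) has_prod (\<Prod>k. (1 - x ^ Suc k) / (1 + x ^ Suc k))"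
    using has_prod_graded_ratio_even[of 2 x] assms has_prod_unique by fastforce
  then have lim: "gauss_prod x \<longlonglongrightarrow> (\<Prod>k. (1 - x ^ Suc k) / (1 + x ^ Suc k))"
    unfolding gauss_prod_def by (rule has_prod_imp_tendsto')
  have "(\<lambda>n. real n * x ^ n) \<longlonglongrightarrow> 0"
    using assms by (intro powser_times_n_limit_0) auto
  then have null: "(\<lambda>n. 2 * (real n * x ^ n)) \<longlonglongrightarrow> 0"
    using tendsto_mult_right_zero by blast
  have "norm (\<Sum>j<n. shanks_term x n (Suc j)) \<le> 2 * (real n * x ^ n)" for n
  proof -
    have "norm (\<Sum>j<n. shanks_term x n (Suc j)) \<le> (\<Sum>j<n. 2 * x ^ n)"
      by (rule sum_norm_le) (use abs_shanks_term_le[OF assms] in auto)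
    then show ?thesis
      by simp
  qed
  then have "(\<lambda>n. \<Sum>j<n. shanks_term x n (Suc j)) \<longlonglongrightarrow> 0"
    by (intro Lim_null_comparison[OF _ null]) auto
  then have "(\<lambda>n. gauss_prod x n + (\<Sum>j<n. shanks_term x n (Suc j)))
      \<longlonglongrightarrow> (\<Prod>k. (1 - x ^ Suc k) / (1 + x ^ Suc k)) + 0"
    by (rule tendsto_add[OF lim])
  \<comment> \<open>The term \<open>j = 0\<close> is the main term \<open>gauss_prod x n\<close>;
    the rest has just been shown to vanish.\<close>
  moreover have "(\<Sum>j\<le>n. shanks_term x n j)
      = gauss_prod x n + (\<Sum>j<n. shanks_term x n (Suc j))" for n
    unfolding lessThan_Suc_atMost[symmetric] sum.lessThan_Suc_shift by (simp add: shanks_term_def)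
  ultimately show ?thesis
    by (simp only: theta4_partial_sum[OF assms] add_0_right)
qed

text \<open>This lets an unordered sum over the integers be evaluated along symmetric intervals: a
  finite set lies in all of them once \<open>n\<close> exceeds its largest absolute value.\<close>

lemma filterlim_int_interval_finite_subsets_at_top:
  "filterlim (\<lambda>n. {- int n..int n}) (finite_subsets_at_top UNIV) sequentially"
  unfolding filterlim_finite_subsets_at_top
proof (intro allI impI)
  fix X :: "int set"
  assume "finite X \<and> X \<subseteq> UNIV"
  then obtain m where m: "\<And>i. i \<in> X \<Longrightarrow> \<bar>i\<bar> \<le> m"
    using bdd_above_finite[of "abs ` X"] unfolding bdd_above_def by auto
  show "\<forall>\<^sub>F n in sequentially. finite {- int n..int n} \<and> X \<subseteq> {- int n..int n} \<and> {- int n..int n} \<subseteq> UNIV"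
    using eventually_ge_at_top[of "nat m"] by eventually_elim (use m in force)
qed

lemma sum_int_interval_even:
  fixes f :: "int \<Rightarrow> real"
  assumes "\<And>i. f (- i) = f i"
  shows "(\<Sum>i\<in>{- int n..int n}. f i) = f 0 + 2 * (\<Sum>j<n. f (int (Suc j)))"
proof (induction n)
  case (Suc n)
  have "{- int (Suc n)..int (Suc n)} = insert (- int (Suc n)) (insert (int (Suc n)) {- int n..int n})"
    by auto
  then have "(\<Sum>i\<in>{- int (Suc n)..int (Suc n)}. f i)
      = f (- int (Suc n)) + (f (int (Suc n)) + (\<Sum>i\<in>{- int n..int n}. f i))"
    by (simp del: of_nat_Suc)
  with Suc.IH show ?case
    using assms[of "int (Suc n)"] by simp
qed simp

lemma prodinf_gauss_eq_theta4_zero: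
  fixes x :: real
  assumes "0 < x" "x < 1"
  shows "(\<Prod>k. (1 - x ^ Suc k) / (1 + x ^ Suc k)) = theta4_zero x"
proof -
  let ?f = "\<lambda>n::int. (-1) powi n * x powi (n\<^sup>2)"
  have "(sum ?f \<longlongrightarrow> theta4_zero x) (finite_subsets_at_top UNIV)"
    using has_sum_infsum[OF theta4_zero_summable[OF assms]]
    unfolding theta4_zero_def has_sum_def .
  then have "(\<lambda>n. sum ?f {- int n..int n}) \<longlonglongrightarrow> theta4_zero x"
    by (rule filterlim_compose[OF _ filterlim_int_interval_finite_subsets_at_top])
  \<comment> \<open>The summand is even in its index, so the symmetric sum folds into the one-sided
    form whose limit is the Gauss product.\<close>
  moreover have "sum ?f {- int n..int n} = 1 + 2 * (\<Sum>j<n. (-1) ^ Suc j * x ^ (Suc j)\<^sup>2)" for n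
  proof -
    have "?f (int (Suc j)) = (-1) ^ Suc j * x ^ (Suc j)\<^sup>2" for j
      by (simp only: of_nat_power[symmetric] power_int_of_nat)
    moreover have "?f (- i) = ?f i" for i
      by (simp add: power_int_minus power_int_inverse[symmetric])
    ultimately show ?thesis
      using sum_int_interval_even[of ?f n] by simp
  qed
  ultimately show ?thesis
    using theta4_partial_sum_tendsto[OF assms] LIMSEQ_unique by simp
qed

theorem mainTheorem2:
  fixes s :: nat and x :: real
  assumes "s \<ge> 1" and "0 < x" and "x < 1"
  shows
    "(even s \<longrightarrow>
        (\<lambda>k. (1 - x ^ Suc k) / (1 + x ^ Suc k))
          has_prod (graded_parafermionic_Z s x / parafermionic_Z s x) \<and>
        (\<Prod>k. (1 - x ^ Suc k) / (1 + x ^ Suc k)) = theta4_zero x)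
     \<and>
     (odd s \<longrightarrow>
        (\<lambda>k. ((1 - x ^ Suc k) * (1 + x ^ (s * Suc k))) / ((1 + x ^ Suc k) * (1 - x ^ (s * Suc k))))
          has_prod (graded_parafermionic_Z s x / parafermionic_Z s x) \<and>
        (\<Prod>k. ((1 - x ^ Suc k) * (1 + x ^ (s * Suc k))) / ((1 + x ^ Suc k) * (1 - x ^ (s * Suc k))))
          = theta4_zero x / theta4_zero (x ^ s))"
proof (intro conjI impI)
  let ?g = "\<lambda>(y::real) k. (1 - y ^ Suc k) / (1 + y ^ Suc k)"
  have conv: "convergent_prod (?g y)" if "0 < y" "y < 1" for y
    using has_prod_graded_ratio_even[of 2 y] that unfolding has_prod_iff by simp
  have xs: "0 < x ^ s" "x ^ s < 1"
    using assms by (simp_all add: power_less_one_iff)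
  \<comment> \<open>The odd product is, factor by factor, the quotient of the Gauss products with
    nomes \<open>x\<close> and \<open>x ^ s\<close>.\<close>
  have "(\<Prod>k. ?g x k / ?g (x ^ s) k) = theta4_zero x / theta4_zero (x ^ s)"
    using prodinf_divide[OF conv[OF assms(2,3)] conv[OF xs]]
    unfolding prodinf_gauss_eq_theta4_zero[OF assms(2,3)] prodinf_gauss_eq_theta4_zero[OF xs]
    by (rule sym)
  moreover have "?g x k / ?g (x ^ s) k
      = ((1 - x ^ Suc k) * (1 + x ^ (s * Suc k))) / ((1 + x ^ Suc k) * (1 - x ^ (s * Suc k)))" for k
    by (simp only: power_mult divide_divide_times_eq)
  ultimately show "(\<Prod>k. ((1 - x ^ Suc k) * (1 + x ^ (s * Suc k))) / ((1 + x ^ Suc k) * (1 - x ^ (s * Suc k))))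
      = theta4_zero x / theta4_zero (x ^ s)"
    by simp
qed (use assms in \<open>blast intro: has_prod_graded_ratio_even has_prod_graded_ratio_odd
        prodinf_gauss_eq_theta4_zero\<close>)+

end
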